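(* Let $k$ be a positive integer, $S_1,S_2$ finite sets, $\varphi_1\colon 2^{S_1}\to\mathbb{R}_+$ a coverage function and $\varphi_2\colon 2^{S_2}\to\mathbb{R}_+$ a $k$-alternating function. Then $\varphi_1$ and $\varphi_2$ have a tensor product $\varphi\colon 2^{S_1\times S_2}\to\mathbb{R}_+$ which is $k$-alternating, and which is integer-valued if $\varphi_1$ and $\varphi_2$ are integer-valued.
   Context: A function $\varphi\colon 2^S\to\mathbb{R}_+$ is $k$-alternating if $\varphi(\emptyset)=0$ and $\sum_{K\subseteq[k]}(-1)^{|K|}\varphi(A_0\cup\bigcup_{i\in K}A_i)\le 0$ for all $A_0,A_1,\dots,A_k\subseteq S$. A coverage function is a function of the form $\varphi(X)=\sum_{t\in N(X)}w_t$ for a bipartite graph $G=(S,T;E)$ and weights $w\in\mathbb{R}_+^T$, where $N(X)$ is the neighbourhood of $X$ in $G$ (equivalently, $\varphi$ is $k$-alternating for every positive integer $k$). A tensor product of $\varphi_1,\varphi_2$ is a function $\varphi$ on $2^{S_1\times S_2}$ with $\varphi(X_1\times X_2)=\varphi_1(X_1)\varphi_2(X_2)$ for all $X_1\subseteq S_1$, $X_2\subseteq S_2$. *)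

theory Defs
  imports Complex_Main "HOL-Library.FuncSet"
begin

text \<open>
  A set function on \<open>2\<^sup>S\<close> is a total function \<open>'a set \<Rightarrow> real\<close> of which only the values on
  subsets of \<open>S\<close> matter; \<open>\<phi> \<in> Pow S \<rightarrow> {0..}\<close> expresses \<open>\<phi> : 2\<^sup>S \<rightarrow> \<real>\<^sub>+\<close>.
\<close>

definition k_alternating :: "nat \<Rightarrow> 'a set \<Rightarrow> ('a set \<Rightarrow> real) \<Rightarrow> bool" where
  "k_alternating k S \<phi> \<longleftrightarrow>
     \<phi> \<in> Pow S \<rightarrow> {0..} \<and> \<phi> {} = 0 \<and>
     (\<forall>A :: nat \<Rightarrow> 'a set. (\<forall>i\<in>{0..k}. A i \<subseteq> S) \<longrightarrow>
        (\<Sum>K\<in>Pow {1..k}. (-1) ^ card K * \<phi> (A 0 \<union> (\<Union>i\<in>K. A i))) \<le> 0)"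

text \<open>
  The bipartite graph \<open>(S, T; E)\<close> is given by its edge relation \<open>E \<subseteq> S \<times> T\<close>, so the
  neighbourhood \<open>N(X)\<close> of \<open>X \<subseteq> S\<close> is the relational image \<open>E `` X\<close>.
\<close>

definition coverage_representation ::
    "'a set \<Rightarrow> 't set \<Rightarrow> ('a \<times> 't) set \<Rightarrow> ('t \<Rightarrow> real) \<Rightarrow> ('a set \<Rightarrow> real) \<Rightarrow> bool" where
  "coverage_representation S T E w \<phi> \<longleftrightarrow>
     finite T \<and> E \<subseteq> S \<times> T \<and> w \<in> T \<rightarrow> {0..} \<and> (\<forall>X\<subseteq>S. \<phi> X = (\<Sum>t\<in>E `` X. w t))"

text \<open>
  Taking the finite class \<open>T\<close> inside \<open>nat\<close> loses no generality, by
  \<open>coverage_representation_imp_coverage_function\<close> below.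
\<close>

definition coverage_function :: "'a set \<Rightarrow> ('a set \<Rightarrow> real) \<Rightarrow> bool" where
  "coverage_function S \<phi> \<longleftrightarrow>
     (\<exists>(T :: nat set) E w. coverage_representation S T E w \<phi>)"

lemma coverage_representation_imp_coverage_function:
  assumes "coverage_representation S (T :: 't set) E w \<phi>"
  shows "coverage_function S \<phi>"
proof -
  have fin: "finite T" and E: "E \<subseteq> S \<times> T" and w: "w \<in> T \<rightarrow> {0..}"
    and \<phi>: "\<And>X. X \<subseteq> S \<Longrightarrow> \<phi> X = (\<Sum>t\<in>E `` X. w t)"
    using assms by (auto simp: coverage_representation_def)
  obtain h :: "'t \<Rightarrow> nat" where h: "inj_on h T"
    using finite_imp_inj_to_nat_seg[OF fin] by auto
  define F where "F = map_prod id h ` E"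
  define v where "v = w \<circ> inv_into T h"
  have "\<phi> X = (\<Sum>n\<in>F `` X. v n)" if "X \<subseteq> S" for X
  proof -
    have sub: "E `` X \<subseteq> T" using E by auto
    have "F `` X = h ` (E `` X)" by (force simp: F_def)
    also have "(\<Sum>n\<in>h ` (E `` X). v n) = (\<Sum>t\<in>E `` X. v (h t))"
      using sum.reindex[OF inj_on_subset[OF h sub], of v] by simp
    also have "\<dots> = (\<Sum>t\<in>E `` X. w t)"
      using sub h by (intro sum.cong) (auto simp: v_def inv_into_f_f subset_iff)
    finally show ?thesis using \<phi>[OF that] by simp
  qed
  moreover have "F \<subseteq> S \<times> h ` T" using E by (auto simp: F_def)
  moreover have "v \<in> h ` T \<rightarrow> {0..}" using w h by (auto simp: v_def inv_into_f_f)
  ultimately have "coverage_representation S (h ` T) F v \<phi>"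
    using fin by (simp add: coverage_representation_def)
  then show ?thesis by (auto simp: coverage_function_def)
qed

definition tensor_product ::
    "'a set \<Rightarrow> 'b set \<Rightarrow> ('a set \<Rightarrow> real) \<Rightarrow> ('b set \<Rightarrow> real) \<Rightarrow> (('a \<times> 'b) set \<Rightarrow> real) \<Rightarrow> bool" where
  "tensor_product S1 S2 \<phi>1 \<phi>2 \<phi> \<longleftrightarrow>
     (\<forall>X1\<subseteq>S1. \<forall>X2\<subseteq>S2. \<phi> (X1 \<times> X2) = \<phi>1 X1 * \<phi>2 X2)"

definition integer_valued :: "'a set \<Rightarrow> ('a set \<Rightarrow> real) \<Rightarrow> bool" where
  "integer_valued S \<phi> \<longleftrightarrow> \<phi> \<in> Pow S \<rightarrow> \<int>"

end

(*
  Grouping the vertices of T by their neighbourhoods B, a coverage function on S1 is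
  X |-> sum of W B over the B that meet X, with W >= 0.  The tensor product is
  Z |-> sum of W B * phi2 (Z `` B) over the nonempty B: each Z |-> Z `` B commutes with
  unions, so every summand inherits k-alternation, and (X1 x X2) `` B is X2 or empty
  according to whether B meets X1.  If phi1 is integer-valued then so is W on nonempty
  sets, by Moebius inversion, although the original weights on T need not be integral.
*)
theory Submission
  imports Defs
begin

lemma coverage_function_hitting_weights:
  assumes "finite S" and "coverage_function S \<phi>"
  obtains W where "\<And>B. 0 \<le> W B"
    and "\<And>X. X \<subseteq> S \<Longrightarrow> \<phi> X = (\<Sum>B\<in>{B\<in>Pow S. B \<inter> X \<noteq> {}}. W B)"
proof -
  obtain T :: "nat set" and E w where "coverage_representation S T E w \<phi>"
    using assms by (auto simp: coverage_function_def)
  then have T: "finite T" and E: "E \<subseteq> S \<times> T" and w: "\<And>t. t \<in> T \<Longrightarrow> 0 \<le> w t"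
    and \<phi>: "\<And>X. X \<subseteq> S \<Longrightarrow> \<phi> X = (\<Sum>t\<in>E `` X. w t)"
    by (auto simp: coverage_representation_def)
  define N where "N t = {s. (s, t) \<in> E}" for t
  define W where "W B = (\<Sum>t\<in>{t\<in>T. N t = B}. w t)" for B
  have "\<phi> X = (\<Sum>B\<in>{B\<in>Pow S. B \<inter> X \<noteq> {}}. W B)" if "X \<subseteq> S" for X
  proof -
    have "E `` X \<subseteq> T"
      using E by auto
    then have "finite (E `` X)"
      using T by (rule finite_subset)
    \<comment> \<open>A vertex \<open>t\<close> is a neighbour of \<open>X\<close> exactly when
      \<open>N t\<close> meets \<open>X\<close>, so grouping the neighbours of \<open>X\<close> by
      \<open>N\<close> involves only sets that meet \<open>X\<close>.\<close>
    moreover have "N ` (E `` X) \<subseteq> {B\<in>Pow S. B \<inter> X \<noteq> {}}"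
      using E by (auto simp: N_def)
    ultimately have "(\<Sum>t\<in>E `` X. w t)
        = (\<Sum>B\<in>{B\<in>Pow S. B \<inter> X \<noteq> {}}. \<Sum>t\<in>{t\<in>E `` X. N t = B}. w t)"
      using assms(1) by (intro sum.group[symmetric]) auto
    \<comment> \<open>If \<open>B\<close> meets \<open>X\<close>, every \<open>t\<close> in
      \<open>T\<close> with \<open>N t = B\<close> is already a neighbour of \<open>X\<close>, so
      each group is a whole fibre of \<open>N\<close> over \<open>T\<close>.\<close>
    also have "\<dots> = (\<Sum>B\<in>{B\<in>Pow S. B \<inter> X \<noteq> {}}. W B)"
      unfolding W_def using E by (intro sum.cong refl) (auto simp: N_def)
    finally show ?thesis
      using \<phi>[OF that] by simp
  qed
  moreover have "0 \<le> W B" for B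
    unfolding W_def using w by (auto intro: sum_nonneg)
  ultimately show thesis
    using that by blast
qed

text \<open>The difference \<open>\<phi> S - \<phi> (S - B)\<close> is the total weight of the
  nonempty subsets of \<open>B\<close>. Induction along proper inclusion makes every term of it
  except \<open>W B\<close> an integer, hence \<open>W B\<close> as well.\<close>

lemma hitting_weights_Ints:
  fixes W :: "'a set \<Rightarrow> real"
  assumes "finite S"
    and \<phi>: "\<And>X. X \<subseteq> S \<Longrightarrow> \<phi> X = (\<Sum>B\<in>{B\<in>Pow S. B \<inter> X \<noteq> {}}. W B)"
    and int: "integer_valued S \<phi>"
    and "B \<subseteq> S" and "B \<noteq> {}"
  shows "W B \<in> \<int>"
proof -
  have "finite B"
    using assms finite_subset by blast
  then show ?thesis
    using \<open>B \<subseteq> S\<close> \<open>B \<noteq> {}\<close>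
  proof (induction rule: finite_psubset_induct)
    case (psubset B)
    \<comment> \<open>A nonempty subset of \<open>S\<close> either meets \<open>S - B\<close> or
      lies inside \<open>B\<close>, and never both.\<close>
    have hit: "{C\<in>Pow S. C \<inter> S \<noteq> {}} = {C\<in>Pow S. C \<inter> (S - B) \<noteq> {}} \<union> (Pow B - {{}})"
      using psubset.prems by auto
    have "\<phi> S = \<phi> (S - B) + (\<Sum>C\<in>Pow B - {{}}. W C)"
      unfolding \<phi>[OF order_refl] \<phi>[OF Diff_subset] hit
      using \<open>finite S\<close> \<open>finite B\<close> by (intro sum.union_disjoint) auto
    also have "(\<Sum>C\<in>Pow B - {{}}. W C) = W B + (\<Sum>C\<in>Pow B - {{}} - {B}. W C)"
      using \<open>finite B\<close> psubset.prems by (intro sum.remove) auto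
    finally have "W B = \<phi> S - \<phi> (S - B) - (\<Sum>C\<in>Pow B - {{}} - {B}. W C)"
      by simp
    moreover have "(\<Sum>C\<in>Pow B - {{}} - {B}. W C) \<in> \<int>"
      using psubset.IH psubset.prems by (intro Ints_sum) auto
    moreover have "\<phi> S \<in> \<int>" "\<phi> (S - B) \<in> \<int>"
      using int by (auto simp: integer_valued_def)
    ultimately show ?case
      by simp
  qed
qed

text \<open>Taking the image of a fixed \<open>B\<close> preserves unions and the empty set, so the
  inequality for a family \<open>A\<close> of relations is the inequality of \<open>\<phi>\<close>
  for the family of their images.\<close>

lemma k_alternating_Image:
  assumes "k_alternating k S2 \<phi>"
  shows "k_alternating k (S1 \<times> S2) (\<lambda>Z. \<phi> (Z `` B))"
  unfolding k_alternating_def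
proof (intro conjI allI impI)
  show "(\<lambda>Z. \<phi> (Z `` B)) \<in> Pow (S1 \<times> S2) \<rightarrow> {0..}"
    using assms by (auto simp: k_alternating_def Pi_iff)
  show "\<phi> ({} `` B) = 0"
    using assms by (simp add: k_alternating_def)
  fix A :: "nat \<Rightarrow> ('b \<times> 'a) set"
  assume "\<forall>i\<in>{0..k}. A i \<subseteq> S1 \<times> S2"
  then have "\<forall>i\<in>{0..k}. A i `` B \<subseteq> S2"
    by blast
  then have "(\<Sum>K\<in>Pow {1..k}. (-1) ^ card K * \<phi> (A 0 `` B \<union> (\<Union>i\<in>K. A i `` B))) \<le> 0"
    using assms unfolding k_alternating_def by (elim conjE allE[of _ "\<lambda>i. A i `` B"]) simp
  moreover have "(A 0 \<union> (\<Union>i\<in>K. A i)) `` B = A 0 `` B \<union> (\<Union>i\<in>K. A i `` B)" for K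
    by blast
  ultimately show "(\<Sum>K\<in>Pow {1..k}. (-1) ^ card K * \<phi> ((A 0 \<union> (\<Union>i\<in>K. A i)) `` B)) \<le> 0"
    by simp
qed

text \<open>The defining conditions are homogeneous linear equations and inequalities in the
  function, so the functions satisfying them form a convex cone.\<close>

lemma k_alternating_weighted_sum:
  assumes "\<And>i. i \<in> I \<Longrightarrow> 0 \<le> c i" and "\<And>i. i \<in> I \<Longrightarrow> k_alternating k S (f i)"
  shows "k_alternating k S (\<lambda>Z. \<Sum>i\<in>I. c i * f i Z)"
  unfolding k_alternating_def
proof (intro conjI allI impI)
  show "(\<lambda>Z. \<Sum>i\<in>I. c i * f i Z) \<in> Pow S \<rightarrow> {0..}"
    using assms by (auto simp: k_alternating_def Pi_iff intro!: sum_nonneg)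
  show "(\<Sum>i\<in>I. c i * f i {}) = 0"
    using assms(2) by (simp add: k_alternating_def)
  fix A :: "nat \<Rightarrow> 'b set"
  assume A: "\<forall>i\<in>{0..k}. A i \<subseteq> S"
  have "(\<Sum>K\<in>Pow {1..k}. (-1) ^ card K * (\<Sum>i\<in>I. c i * f i (A 0 \<union> (\<Union>j\<in>K. A j))))
      = (\<Sum>i\<in>I. c i * (\<Sum>K\<in>Pow {1..k}. (-1) ^ card K * f i (A 0 \<union> (\<Union>j\<in>K. A j))))"
    unfolding sum_distrib_left by (subst sum.swap) (simp add: mult.left_commute)
  also have "\<dots> \<le> 0"
  proof (rule sum_nonpos)
    fix i
    assume "i \<in> I"
    then show "c i * (\<Sum>K\<in>Pow {1..k}. (-1) ^ card K * f i (A 0 \<union> (\<Union>j\<in>K. A j))) \<le> 0"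
      using assms[of i] A unfolding k_alternating_def by (blast intro: mult_nonneg_nonpos)
  qed
  finally show "(\<Sum>K\<in>Pow {1..k}. (-1) ^ card K * (\<Sum>i\<in>I. c i * f i (A 0 \<union> (\<Union>j\<in>K. A j)))) \<le> 0" .
qed

theorem theorem3p12:
  fixes k :: nat
    and S1 :: "'a set" and S2 :: "'b set"
    and \<phi>1 :: "'a set \<Rightarrow> real" and \<phi>2 :: "'b set \<Rightarrow> real"
  assumes "k > 0"
    and "finite S1" and "finite S2"
    and "\<phi>1 \<in> Pow S1 \<rightarrow> {0..}" and "coverage_function S1 \<phi>1"
    and "\<phi>2 \<in> Pow S2 \<rightarrow> {0..}" and "k_alternating k S2 \<phi>2"
  shows "\<exists>\<phi> :: ('a \<times> 'b) set \<Rightarrow> real.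
           \<phi> \<in> Pow (S1 \<times> S2) \<rightarrow> {0..} \<and>
           tensor_product S1 S2 \<phi>1 \<phi>2 \<phi> \<and>
           k_alternating k (S1 \<times> S2) \<phi> \<and>
           (integer_valued S1 \<phi>1 \<and> integer_valued S2 \<phi>2 \<longrightarrow> integer_valued (S1 \<times> S2) \<phi>)"
proof -
  obtain W where W: "\<And>B. 0 \<le> W B"
    and \<phi>1: "\<And>X. X \<subseteq> S1 \<Longrightarrow> \<phi>1 X = (\<Sum>B\<in>{B\<in>Pow S1. B \<inter> X \<noteq> {}}. W B)"
    using coverage_function_hitting_weights assms by blast
  \<comment> \<open>The values of \<open>\<phi>1\<close> do not constrain \<open>W {}\<close>, which
    may fail to be an integer. Omitting the empty index, whose term would be zero, leaves only
    weights that are integers when \<open>\<phi>1\<close> is integer-valued.\<close>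
  define \<phi> where "\<phi> Z = (\<Sum>B\<in>Pow S1 - {{}}. W B * \<phi>2 (Z `` B))" for Z :: "('a \<times> 'b) set"
  have alt: "k_alternating k (S1 \<times> S2) \<phi>"
    unfolding \<phi>_def
    using W assms by (intro k_alternating_weighted_sum k_alternating_Image)
  have "\<phi>2 {} = 0"
    using assms by (simp add: k_alternating_def)
  have "\<phi> (X1 \<times> X2) = \<phi>1 X1 * \<phi>2 X2" if "X1 \<subseteq> S1" for X1 X2
  proof -
    have "\<phi> (X1 \<times> X2) = (\<Sum>B\<in>{B\<in>Pow S1. B \<inter> X1 \<noteq> {}}. W B * \<phi>2 ((X1 \<times> X2) `` B))"
      unfolding \<phi>_def
    proof (intro sum.mono_neutral_right ballI)
      fix B
      assume "B \<in> Pow S1 - {{}} - {B\<in>Pow S1. B \<inter> X1 \<noteq> {}}"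
      then have "(X1 \<times> X2) `` B = {}"
        by blast
      then show "W B * \<phi>2 ((X1 \<times> X2) `` B) = 0"
        using \<open>\<phi>2 {} = 0\<close> by simp
    qed (use assms in auto)
    also have "\<dots> = (\<Sum>B\<in>{B\<in>Pow S1. B \<inter> X1 \<noteq> {}}. W B * \<phi>2 X2)"
    proof (intro sum.cong refl)
      fix B
      assume "B \<in> {B\<in>Pow S1. B \<inter> X1 \<noteq> {}}"
      then have "(X1 \<times> X2) `` B = X2"
        by blast
      then show "W B * \<phi>2 ((X1 \<times> X2) `` B) = W B * \<phi>2 X2"
        by simp
    qed
    finally show ?thesis
      by (simp add: \<phi>1[OF that] sum_distrib_right)
  qed
  moreover have "integer_valued (S1 \<times> S2) \<phi>"
    if "integer_valued S1 \<phi>1" and "integer_valued S2 \<phi>2"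
    unfolding integer_valued_def
  proof
    fix Z
    assume "Z \<in> Pow (S1 \<times> S2)"
    \<comment> \<open>Any image under \<open>Z\<close> is a subset of \<open>S2\<close>, where
      \<open>\<phi>2\<close> takes integer values.\<close>
    then have "\<phi>2 (Z `` B) \<in> \<int>" for B
      using that(2) by (auto simp: integer_valued_def Pi_iff)
    moreover have "W B \<in> \<int>" if "B \<in> Pow S1 - {{}}" for B
      using hitting_weights_Ints[OF \<open>finite S1\<close> \<phi>1 \<open>integer_valued S1 \<phi>1\<close>] that by auto
    ultimately show "\<phi> Z \<in> \<int>"
      unfolding \<phi>_def by (intro Ints_sum Ints_mult)
  qed
  moreover have "\<phi> \<in> Pow (S1 \<times> S2) \<rightarrow> {0..}"
    using alt by (simp add: k_alternating_def)
  ultimately show ?thesis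
    using alt unfolding tensor_product_def by blast
qed

end
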